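(* Let $n\ge1$ be an integer and let $\Omega$ be a bounded domain of $\mathbb{R}^n$ with a Lipschitz continuous boundary. Let $p\in[1,\infty)$, $l\in\mathbb{N}$ and $\sigma_0\in(0,1)$. Then, for any $v\in W^{l+\sigma_0,p}(\Omega)$, we have $|v|_{l,\mathrm{Dini}(p),\Omega}<\infty$ and $$\lim_{\sigma\to0^{+}}|v|_{l+\sigma,p,\Omega}=|v|_{l,\mathrm{Dini}(p),\Omega}.$$
   Context: $\mathbb{N}$ contains $0$. $|\cdot|$ is the Euclidean norm on $\mathbb{R}^n$. For a multi-index $\alpha\in\mathbb{N}^n$, $|\alpha|=\alpha_1+\cdots+\alpha_n$ and $\partial^\alpha$ is the corresponding distributional derivative. For $r\in\mathbb{N}$, $W^{r,p}(\Omega)$ is the usual Sobolev space of $v\in L^p(\Omega)$ with $\partial^\alpha v\in L^p(\Omega)$ for all $|\alpha|\le r$. For $l\in\mathbb{N}$ and $\sigma\in(0,1)$, the intrinsic (Gagliardo) semi-norm of order $l+\sigma$ is the nonnegative quantity defined by $$|v|_{l+\sigma,p,\Omega}^p=\sum_{|\alpha|=l}\int_{\Omega\times\Omega}\frac{|\partial^\alpha v(x)-\partial^\alpha v(y)|^p}{|x-y|^{n+p\sigma}}\,dx\,dy,$$ and $W^{l+\sigma,p}(\Omega)$ is the space of (equivalence classes of) functions $v\in W^{l,p}(\Omega)$ with $|v|_{l+\sigma,p,\Omega}<\infty$. Dini's semi-norm is the nonnegative quantity defined by $$|v|_{l,\mathrm{Dini}(p),\Omega}^p=\sum_{|\alpha|=l}\int_{\Omega\times\Omega}\frac{|\partial^\alpha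 v(x)-\partial^\alpha v(y)|^p}{|x-y|^{n}}\,dx\,dy.$$ *)

theory Defs
  imports "HOL-Analysis.Analysis"
begin

text \<open>
  Near each boundary point, in suitable orthonormal coordinates, the set is the part of a
  ball lying strictly below the graph of a Lipschitz function of the first \<open>n - 1\<close>
  coordinates.  The unit vector \<open>e\<close> is the last coordinate direction; the hyperplane
  orthogonal to \<open>e\<close> carries the other coordinates, \<open>x - (x \<bullet> e) *\<^sub>R e\<close> being the projection
  of \<open>x\<close> onto it.  That the boundary is the graph inside the ball follows from the continuity
  of \<open>g\<close>.
\<close>

definition lipschitz_boundary :: "'a::euclidean_space set \<Rightarrow> bool" where
  "lipschitz_boundary \<Omega> \<longleftrightarrow>
     (\<forall>z\<in>frontier \<Omega>. \<exists>r>0. \<exists>e g L. norm e = 1 \<and> L-lipschitz_on {y. y \<bullet> e = 0} g \<and>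
        \<Omega> \<inter> ball z r = {x \<in> ball z r. x \<bullet> e < (g (x - (x \<bullet> e) *\<^sub>R e) :: real)})"

definition mi_order :: "('n::finite \<Rightarrow> nat) \<Rightarrow> nat" where
  "mi_order \<alpha> = (\<Sum>i\<in>UNIV. \<alpha> i)"

definition partial :: "'n \<Rightarrow> (real^'n \<Rightarrow> real) \<Rightarrow> real^'n \<Rightarrow> real" where
  "partial i f x = deriv (\<lambda>t. f (x + t *\<^sub>R axis i 1)) 0"

definition partials :: "'n list \<Rightarrow> (real^'n \<Rightarrow> real) \<Rightarrow> real^'n \<Rightarrow> real" where
  "partials is f = foldr partial is f"

text \<open>
  The index type carries no order, so the order in which the partial derivatives are taken is
  chosen arbitrarily.  The operator is only applied to smooth functions, for which the choice
  is irrelevant.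
\<close>

definition mi_partial :: "('n \<Rightarrow> nat) \<Rightarrow> (real^'n \<Rightarrow> real) \<Rightarrow> real^'n \<Rightarrow> real" where
  "mi_partial \<alpha> = partials (SOME is. \<forall>i. count_list is i = \<alpha> i)"

lemma ex_list_of_multi_index:
  fixes \<alpha> :: "'n::finite \<Rightarrow> nat"
  shows "\<exists>is. \<forall>i. count_list is i = \<alpha> i"
proof -
  have "\<exists>is. \<forall>i. count_list is i = (if i \<in> A then \<alpha> i else 0)" if "finite A" for A :: "'n set"
    using that
  proof (induction A rule: finite_induct)
    case empty
    then show ?case by (intro exI[of _ "[]"]) simp
  next
    case (insert a A)
    then obtain xs where xs: "\<forall>i. count_list xs i = (if i \<in> A then \<alpha> i else 0)" by blast
    have "count_list (replicate k a) i = (if i = a then k else 0)" for k i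
      by (induction k) auto
    with xs insert.hyps show ?case
      by (intro exI[of _ "replicate (\<alpha> a) a @ xs"]) auto
  qed
  from this[of UNIV] show ?thesis by simp
qed

lemma finite_multi_indices: "finite {\<alpha> :: 'n::finite \<Rightarrow> nat. mi_order \<alpha> = l}"
proof (rule finite_subset)
  show "{\<alpha> :: 'n \<Rightarrow> nat. mi_order \<alpha> = l} \<subseteq> PiE UNIV (\<lambda>_. {..l})"
    unfolding mi_order_def by (auto intro!: member_le_sum)
qed (intro finite_PiE; simp)

text \<open>
  Smoothness is expressed by total differentiability of all iterated partial derivatives.
\<close>

definition test_function :: "(real^'n) set \<Rightarrow> (real^'n \<Rightarrow> real) \<Rightarrow> bool" where
  "test_function \<Omega> \<phi> \<longleftrightarrow>
     (\<forall>is x. partials is \<phi> differentiable (at x)) \<and>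
     (\<exists>K. compact K \<and> K \<subseteq> \<Omega> \<and> (\<forall>x. x \<notin> K \<longrightarrow> \<phi> x = 0))"

text \<open>
  Elements of Lebesgue and Sobolev spaces are represented by functions on the whole space of
  which only the restriction to \<open>\<Omega>\<close>, up to null sets, matters.
\<close>

definition locally_integrable :: "(real^'n) set \<Rightarrow> (real^'n \<Rightarrow> real) \<Rightarrow> bool" where
  "locally_integrable \<Omega> v \<longleftrightarrow>
     (\<forall>K. compact K \<and> K \<subseteq> \<Omega> \<longrightarrow> integrable (lebesgue_on K) v)"

definition is_weak_deriv ::
  "(real^'n) set \<Rightarrow> ('n::finite \<Rightarrow> nat) \<Rightarrow> (real^'n \<Rightarrow> real) \<Rightarrow> (real^'n \<Rightarrow> real) \<Rightarrow> bool" where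
  "is_weak_deriv \<Omega> \<alpha> v w \<longleftrightarrow>
     locally_integrable \<Omega> v \<and> locally_integrable \<Omega> w \<and>
     (\<forall>\<phi>. test_function \<Omega> \<phi> \<longrightarrow>
        (LINT x|lebesgue_on \<Omega>. v x * mi_partial \<alpha> \<phi> x) =
        (-1) ^ mi_order \<alpha> * (LINT x|lebesgue_on \<Omega>. w x * \<phi> x))"

text \<open>
  A representative of the distributional derivative, which is unique up to null subsets of the
  open set \<open>\<Omega>\<close> whenever it is a locally integrable function.
\<close>

definition weak_deriv ::
  "(real^'n) set \<Rightarrow> ('n::finite \<Rightarrow> nat) \<Rightarrow> (real^'n \<Rightarrow> real) \<Rightarrow> real^'n \<Rightarrow> real" where
  "weak_deriv \<Omega> \<alpha> v = (SOME w. is_weak_deriv \<Omega> \<alpha> v w)"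

definition Lp :: "real \<Rightarrow> (real^'n) set \<Rightarrow> (real^'n \<Rightarrow> real) set" where
  "Lp p \<Omega> = {v \<in> borel_measurable (lebesgue_on \<Omega>).
               integrable (lebesgue_on \<Omega>) (\<lambda>x. \<bar>v x\<bar> powr p)}"

definition sobolev :: "nat \<Rightarrow> real \<Rightarrow> (real^'n) set \<Rightarrow> (real^'n \<Rightarrow> real) set" where
  "sobolev r p \<Omega> = {v \<in> Lp p \<Omega>. \<forall>\<alpha>. mi_order \<alpha> \<le> r \<longrightarrow>
     (\<exists>w. is_weak_deriv \<Omega> \<alpha> v w) \<and> weak_deriv \<Omega> \<alpha> v \<in> Lp p \<Omega>}"

definition ennreal_root :: "real \<Rightarrow> ennreal \<Rightarrow> ennreal" where
  "ennreal_root p a = (if a = \<infinity> then \<infinity> else ennreal (enn2real a powr (1 / p)))"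

text \<open>
  Both semi-norms take values in \<open>[0, \<infinity>]\<close>.  On the diagonal, which is a null set, the
  integrands are \<open>0\<close> because of the convention \<open>x / 0 = 0\<close>.
\<close>

definition gagliardo ::
  "nat \<Rightarrow> real \<Rightarrow> real \<Rightarrow> (real^'n) set \<Rightarrow> (real^'n \<Rightarrow> real) \<Rightarrow> ennreal" where
  "gagliardo l \<sigma> p \<Omega> v = ennreal_root p
     (\<Sum>\<alpha> | mi_order \<alpha> = l.
        \<integral>\<^sup>+ (x, y). ennreal (\<bar>weak_deriv \<Omega> \<alpha> v x - weak_deriv \<Omega> \<alpha> v y\<bar> powr p
                           / norm (x - y) powr (real CARD('n) + p * \<sigma>))
        \<partial>(lebesgue_on \<Omega> \<Otimes>\<^sub>M lebesgue_on \<Omega>))"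

definition dini ::
  "nat \<Rightarrow> real \<Rightarrow> (real^'n) set \<Rightarrow> (real^'n \<Rightarrow> real) \<Rightarrow> ennreal" where
  "dini l p \<Omega> v = ennreal_root p
     (\<Sum>\<alpha> | mi_order \<alpha> = l.
        \<integral>\<^sup>+ (x, y). ennreal (\<bar>weak_deriv \<Omega> \<alpha> v x - weak_deriv \<Omega> \<alpha> v y\<bar> powr p
                           / norm (x - y) ^ CARD('n))
        \<partial>(lebesgue_on \<Omega> \<Otimes>\<^sub>M lebesgue_on \<Omega>))"

definition sobolev_frac ::
  "nat \<Rightarrow> real \<Rightarrow> real \<Rightarrow> (real^'n) set \<Rightarrow> (real^'n \<Rightarrow> real) set" where
  "sobolev_frac l \<sigma> p \<Omega> = {v \<in> sobolev l p \<Omega>. gagliardo l \<sigma> p \<Omega> v < \<infinity>}"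

end

theory Submission
  imports Defs
begin

text \<open>
  The theorem is an instance of dominated convergence on \<open>\<Omega> \<times> \<Omega>\<close>.  Away from the diagonal the
  Gagliardo integrand \<open>F / d powr (n + p * \<sigma>)\<close>, with \<open>F\<close> the \<open>p\<close>-th power of the difference
  of a derivative at two points and \<open>d\<close> their distance, depends continuously on \<open>\<sigma>\<close>, and at
  \<open>\<sigma> = 0\<close> it is Dini's integrand.  Since \<open>\<Omega>\<close> is bounded, \<open>d\<close> is at most some \<open>D\<close>, so
  lowering the exponent from \<open>n + p * \<sigma>\<^sub>0\<close> increases the integrand at most by the constant factor
  \<open>max 1 D powr (p * \<sigma>\<^sub>0)\<close> (lemma \<open>kernel_le\<close>).  The integrand of the finite semi-norm of order
  \<open>l + \<sigma>\<^sub>0\<close> thus dominates all those with \<open>0 \<le> \<sigma> \<le> \<sigma>\<^sub>0\<close>, which gives both the finiteness of Dini's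
  semi-norm and the limit (lemmas \<open>nn_integral_kernel_finite\<close> and
  \<open>nn_integral_kernel_tendsto\<close>).
\<close>

text \<open>
  For \<open>d > 0\<close> the quotient of the two sides without the constant is \<open>d powr (t - s)\<close>, whose
  exponent lies in \<open>[0, t]\<close>; the maximum with \<open>1\<close> makes the bound monotone in the exponent.  For
  \<open>d = 0\<close> both sides vanish by the convention \<open>x / 0 = 0\<close>.
\<close>

lemma kernel_le:
  fixes F d k s t D :: real
  assumes "0 \<le> F" "0 \<le> d" "d \<le> D" "0 \<le> s" "s \<le> t"
  shows "ennreal (F / d powr (k + s)) \<le> ennreal (max 1 D powr t) * ennreal (F / d powr (k + t))"
proof (cases "d = 0")
  case False
  then have d: "d > 0" using assms by simp
  have "d powr (t - s) \<le> max 1 D powr (t - s)"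
    using assms by (intro powr_mono2) auto
  also have "\<dots> \<le> max 1 D powr t"
    using assms by (intro powr_mono) auto
  finally have le: "d powr (t - s) \<le> max 1 D powr t" .
  have "d powr (k + t) = d powr (k + s) * d powr (t - s)"
    by (simp flip: powr_add)
  then have "F / d powr (k + s) = d powr (t - s) * (F / d powr (k + t))"
    using d by simp
  also have "\<dots> \<le> max 1 D powr t * (F / d powr (k + t))"
    using le assms by (intro mult_right_mono) auto
  finally have "F / d powr (k + s) \<le> max 1 D powr t * (F / d powr (k + t))" .
  then have "ennreal (F / d powr (k + s)) \<le> ennreal (max 1 D powr t * (F / d powr (k + t)))"
    by (rule ennreal_leI)
  also have "\<dots> = ennreal (max 1 D powr t) * ennreal (F / d powr (k + t))"
    using assms by (intro ennreal_mult) auto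
  finally show ?thesis .
qed simp

lemma nn_integral_kernel_finite:
  fixes F d :: "'a \<Rightarrow> real"
  assumes [measurable]: "F \<in> borel_measurable M" "d \<in> borel_measurable M"
    and nonneg: "\<And>z. z \<in> space M \<Longrightarrow> 0 \<le> F z" "\<And>z. z \<in> space M \<Longrightarrow> 0 \<le> d z"
    and bound: "\<And>z. z \<in> space M \<Longrightarrow> d z \<le> D"
    and fin: "(\<integral>\<^sup>+ z. ennreal (F z / d z powr (k + t)) \<partial>M) < \<infinity>"
    and s: "0 \<le> s" "s \<le> t"
  shows "(\<integral>\<^sup>+ z. ennreal (F z / d z powr (k + s)) \<partial>M) < \<infinity>"
proof -
  have "(\<integral>\<^sup>+ z. ennreal (F z / d z powr (k + s)) \<partial>M)
      \<le> (\<integral>\<^sup>+ z. ennreal (max 1 D powr t) * ennreal (F z / d z powr (k + t)) \<partial>M)"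
    using nonneg bound s
    by (intro nn_integral_mono kernel_le) auto
  also have "\<dots> = ennreal (max 1 D powr t) * (\<integral>\<^sup>+ z. ennreal (F z / d z powr (k + t)) \<partial>M)"
    by (rule nn_integral_cmult) measurable
  also have "\<dots> < \<infinity>"
    using fin by (simp add: ennreal_mult_less_top)
  finally show ?thesis .
qed

lemma nn_integral_kernel_tendsto:
  fixes F d :: "'a \<Rightarrow> real"
  assumes [measurable]: "F \<in> borel_measurable M" "d \<in> borel_measurable M"
    and nonneg: "\<And>z. z \<in> space M \<Longrightarrow> 0 \<le> F z" "\<And>z. z \<in> space M \<Longrightarrow> 0 \<le> d z"
    and bound: "\<And>z. z \<in> space M \<Longrightarrow> d z \<le> D"
    and fin: "(\<integral>\<^sup>+ z. ennreal (F z / d z powr (k + t)) \<partial>M) < \<infinity>"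
    and s: "\<And>i. 0 \<le> s i" "\<And>i. s i \<le> t" "s \<longlonglongrightarrow> 0"
  shows "(\<lambda>i. \<integral>\<^sup>+ z. ennreal (F z / d z powr (k + s i)) \<partial>M)
           \<longlonglongrightarrow> (\<integral>\<^sup>+ z. ennreal (F z / d z powr k) \<partial>M)"
proof (rule nn_integral_dominated_convergence
    [where w = "\<lambda>z. ennreal (max 1 D powr t) * ennreal (F z / d z powr (k + t))"])
  show "AE z in M. ennreal (F z / d z powr (k + s i))
          \<le> ennreal (max 1 D powr t) * ennreal (F z / d z powr (k + t))" for i
    using nonneg bound s(1,2)
    by (intro AE_I2 kernel_le) auto
  have "(\<integral>\<^sup>+ z. ennreal (max 1 D powr t) * ennreal (F z / d z powr (k + t)) \<partial>M)
      = ennreal (max 1 D powr t) * (\<integral>\<^sup>+ z. ennreal (F z / d z powr (k + t)) \<partial>M)"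
    by (rule nn_integral_cmult) measurable
  then show "(\<integral>\<^sup>+ z. ennreal (max 1 D powr t) * ennreal (F z / d z powr (k + t)) \<partial>M) < \<infinity>"
    using fin by (simp add: ennreal_mult_less_top)
  have "(\<lambda>i. F z / d z powr (k + s i)) \<longlonglongrightarrow> F z / d z powr k" for z
  proof (cases "d z = 0")
    case False
    have "(\<lambda>i. d z powr (k + s i)) \<longlonglongrightarrow> d z powr (k + 0)"
      using False s(3) by (intro tendsto_intros) auto
    then show ?thesis
      using False by (intro tendsto_divide tendsto_const) auto
  qed simp
  then show "AE z in M. (\<lambda>i. ennreal (F z / d z powr (k + s i))) \<longlonglongrightarrow> ennreal (F z / d z powr k)"
    by (intro AE_I2 tendsto_ennrealI)
qed measurable

lemma ennreal_root_less_top_iff: "ennreal_root p a < top \<longleftrightarrow> a < top"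
  by (auto simp: ennreal_root_def less_top)

lemma tendsto_ennreal_root:
  assumes "(f \<longlongrightarrow> a) G" "a < \<infinity>" "p > 0"
  shows "((\<lambda>x. ennreal_root p (f x)) \<longlongrightarrow> ennreal_root p a) G"
proof -
  have "((\<lambda>x. ennreal (enn2real (f x) powr (1 / p))) \<longlongrightarrow> ennreal (enn2real a powr (1 / p))) G"
    using assms by (intro tendsto_ennrealI tendsto_powr2 tendsto_enn2real) (auto simp: less_top)
  moreover have "\<forall>\<^sub>F x in G. f x < \<infinity>"
    using assms(1,2) by (rule order_tendstoD)
  then have "\<forall>\<^sub>F x in G. ennreal (enn2real (f x) powr (1 / p)) = ennreal_root p (f x)"
    by eventually_elim (simp add: ennreal_root_def)
  ultimately have "((\<lambda>x. ennreal_root p (f x)) \<longlongrightarrow> ennreal (enn2real a powr (1 / p))) G"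
    by (rule Lim_transform_eventually)
  then show ?thesis
    using assms(2) by (auto simp: ennreal_root_def[of p a])
qed

theorem theorem3p5:
  fixes \<Omega> :: "(real^'n) set" and v :: "real^'n \<Rightarrow> real"
    and p \<sigma>\<^sub>0 :: real and l :: nat
  assumes "open \<Omega>" and "connected \<Omega>" and "\<Omega> \<noteq> {}" and "bounded \<Omega>"
    and "lipschitz_boundary \<Omega>"
    and "1 \<le> p" and "0 < \<sigma>\<^sub>0" and "\<sigma>\<^sub>0 < 1"
    and "v \<in> sobolev_frac l \<sigma>\<^sub>0 p \<Omega>"
  shows "dini l p \<Omega> v < \<infinity> \<and>
         ((\<lambda>\<sigma>. gagliardo l \<sigma> p \<Omega> v) \<longlongrightarrow> dini l p \<Omega> v) (at_right 0)"
proof -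
  let ?A = "{\<alpha> :: 'n \<Rightarrow> nat. mi_order \<alpha> = l}"
  let ?M = "lebesgue_on \<Omega> \<Otimes>\<^sub>M lebesgue_on \<Omega>"
  define F where "F \<alpha> z = \<bar>weak_deriv \<Omega> \<alpha> v (fst z) - weak_deriv \<Omega> \<alpha> v (snd z)\<bar> powr p" for \<alpha> z
  define d :: "(real^'n) \<times> (real^'n) \<Rightarrow> real" where "d z = norm (fst z - snd z)" for z
  define I where "I s \<alpha> = (\<integral>\<^sup>+ z. ennreal (F \<alpha> z / d z powr (real CARD('n) + s)) \<partial>?M)" for s \<alpha>
  have gagliardo: "gagliardo l \<sigma> p \<Omega> v = ennreal_root p (\<Sum>\<alpha>\<in>?A. I (p * \<sigma>) \<alpha>)" for \<sigma>
    by (simp only: gagliardo_def I_def F_def d_def case_prod_beta')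
  (* The power with a real exponent is 0 at base 0; so is the power with a natural exponent,
     because n \<ge> 1. *)
  have pow: "r powr (real CARD('n) + 0) = r ^ CARD('n)" if "r \<ge> 0" for r :: real
    using that by (cases "r = 0") (auto simp: powr_realpow)
  have dini: "dini l p \<Omega> v = ennreal_root p (\<Sum>\<alpha>\<in>?A. I 0 \<alpha>)"
    by (simp only: dini_def I_def F_def d_def case_prod_beta' pow[OF norm_ge_zero])

  have F_meas: "F \<alpha> \<in> borel_measurable ?M" if "\<alpha> \<in> ?A" for \<alpha>
  proof -
    have [measurable]: "weak_deriv \<Omega> \<alpha> v \<in> borel_measurable (lebesgue_on \<Omega>)"
      using assms(9) that by (auto simp: sobolev_frac_def sobolev_def Lp_def)
    show ?thesis unfolding F_def by measurable
  qed
  have [measurable]: "(\<lambda>x. x) \<in> borel_measurable (lebesgue_on \<Omega>)"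
    by (intro measurable_restrict_space1 measurable_completion) simp
  have d_meas: "d \<in> borel_measurable ?M"
    unfolding d_def by measurable
  obtain B where B: "\<And>x. x \<in> \<Omega> \<Longrightarrow> norm x \<le> B"
    using \<open>bounded \<Omega>\<close> by (auto simp: bounded_iff)
  have d_le: "d z \<le> 2 * B" if "z \<in> space ?M" for z
    using that B[of "fst z"] B[of "snd z"] norm_triangle_ineq4[of "fst z" "snd z"]
    by (auto simp: d_def space_pair_measure)
  have nonneg: "0 \<le> F \<alpha> z" "0 \<le> d z" for \<alpha> z
    by (auto simp: F_def d_def)

  have fin_A: "finite ?A"
    by (rule finite_multi_indices)
  have "(\<Sum>\<alpha>\<in>?A. I (p * \<sigma>\<^sub>0) \<alpha>) < \<infinity>"
    using assms(9) by (simp add: sobolev_frac_def gagliardo ennreal_root_less_top_iff)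
  then have fin: "I (p * \<sigma>\<^sub>0) \<alpha> < \<infinity>" if "\<alpha> \<in> ?A" for \<alpha>
    using that fin_A by simp

  have "I 0 \<alpha> < \<infinity>" if "\<alpha> \<in> ?A" for \<alpha>
    unfolding I_def
    by (rule nn_integral_kernel_finite[OF F_meas[OF that] d_meas nonneg d_le
          fin[OF that, unfolded I_def]]) (use assms in auto)
  then have sum_fin: "(\<Sum>\<alpha>\<in>?A. I 0 \<alpha>) < \<infinity>"
    using fin_A by simp

  (* The limit is taken inside [0, \<sigma>\<^sub>0], where the domination holds along the whole sequence. *)
  have "((\<lambda>\<sigma>. I (p * \<sigma>) \<alpha>) \<longlongrightarrow> I 0 \<alpha>) (at 0 within {0..\<sigma>\<^sub>0})" if "\<alpha> \<in> ?A" for \<alpha>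
    unfolding tendsto_at_iff_sequentially
  proof (intro allI impI)
    fix X :: "nat \<Rightarrow> real"
    assume X: "\<forall>i. X i \<in> {0..\<sigma>\<^sub>0} - {0}" "X \<longlonglongrightarrow> 0"
    have "(\<lambda>i. I (p * X i) \<alpha>) \<longlonglongrightarrow> I 0 \<alpha>"
      unfolding I_def add_0_right[of "real CARD('n)"]
    proof (rule nn_integral_kernel_tendsto[OF F_meas[OF that] d_meas nonneg d_le
          fin[OF that, unfolded I_def]])
      show "0 \<le> p * X i" "p * X i \<le> p * \<sigma>\<^sub>0" for i
        using X(1)[rule_format, of i] assms by auto
      show "(\<lambda>i. p * X i) \<longlonglongrightarrow> 0"
        using X(2) by (rule tendsto_mult_right_zero)
    qed
    then show "((\<lambda>\<sigma>. I (p * \<sigma>) \<alpha>) \<circ> X) \<longlonglongrightarrow> I 0 \<alpha>"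
      by (simp add: o_def)
  qed
  then have "((\<lambda>\<sigma>. \<Sum>\<alpha>\<in>?A. I (p * \<sigma>) \<alpha>) \<longlongrightarrow> (\<Sum>\<alpha>\<in>?A. I 0 \<alpha>)) (at_right 0)"
    using \<open>0 < \<sigma>\<^sub>0\<close> by (intro tendsto_sum) (simp add: at_within_Icc_at_right)
  then have "((\<lambda>\<sigma>. gagliardo l \<sigma> p \<Omega> v) \<longlongrightarrow> dini l p \<Omega> v) (at_right 0)"
    unfolding gagliardo dini using sum_fin \<open>1 \<le> p\<close> by (intro tendsto_ennreal_root) auto
  moreover have "dini l p \<Omega> v < \<infinity>"
    using sum_fin by (simp add: dini ennreal_root_less_top_iff)
  ultimately show ?thesis
    by blast
qed

end
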